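(* Let $\mathbb{D}$ be the unit disk of $\mathbb{R}^2$, let $f\in L^1(\mathbb{D})$ and let $\kappa\in\mathbb{R}\setminus\{0\}$. Then for every $\xi=(\xi_1,\xi_2)\in\mathbb{R}^2\setminus\{0\}$, with $\zeta:=-\frac{\xi_1-i\xi_2}{2}\in\mathbb{C}$, $$\mathcal{F}f(\xi)=2\pi\sum_{\ell,m\in\mathbb{Z}}i^{\ell+m}\left(\frac{|\zeta|+\sqrt{|\zeta|^2-\kappa}}{|\zeta|\sqrt\kappa}\right)^{\ell+m}J_\ell(\sqrt\kappa)J_m(\sqrt\kappa)\,\mu^\kappa_{\ell,m}[f]\,\overline{\zeta}^{\,\ell}\zeta^m,$$ and the series is absolutely convergent. In particular, two functions in $L^1(\mathbb{D})$ having the same moments $\mu^\kappa_{\ell,m}$ (for all $\ell,m\in\mathbb{Z}$) are necessarily equal.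
   Context: $J_n$ denotes the Bessel function of the first kind of order $n$, and $\sqrt{\cdot}$ is the principal branch of the square root. The Fourier transform is $\mathcal{F}f(\xi)=\int_{\mathbb{D}}e^{-ix\cdot\xi}f(x)\,\mathrm{d}x$. For $\ell\in\mathbb{Z}$, $e_\ell(e^{i\theta})=\frac{e^{i\ell\theta}}{\sqrt{2\pi}}$ on the unit circle $\mathbb{S}^1$, and for $x\in\mathbb{D}\setminus\{0\}$, $\widehat x=x/|x|\in\mathbb{S}^1$ (identifying $\mathbb{R}^2$ with $\mathbb{C}$). For $\kappa\neq0$ and $\ell\in\mathbb{Z}$, $\phi^\kappa_\ell(r):=\dfrac{J_{|\ell|}(\sqrt\kappa\,r)}{J_{|\ell|}(\sqrt\kappa)}$. The moments are $$\mu^\kappa_{\ell,m}[f]:=\int_{\mathbb{D}}f(x)\,\phi^\kappa_\ell(|x|)\,\phi^\kappa_m(|x|)\,\overline{e_\ell(\widehat x)}\,e_m(\widehat x)\,\mathrm{d}x,\qquad\ell,m\in\mathbb{Z}.$$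
   Formalization: For κ > 0 it is additionally assumed that J_{|ℓ|}(√κ) ≠ 0 for all integers ℓ (κ is not a Dirichlet eigenvalue of the disk), since otherwise φ^κ_ℓ and the moments μ^κ_{ℓ,m} are undefined. *)

theory Defs
  imports "HOL-Analysis.Analysis"
begin

text \<open>
  Points of the plane are elements of \<^typ>\<open>complex\<close>; the dot product of the plane is then the
  inner product \<open>x \<bullet> \<xi> = Re x * Re \<xi> + Im x * Im \<xi>\<close>.
\<close>

abbreviation unit_disk :: "complex set" where
  "unit_disk \<equiv> ball 0 1"

text \<open>
  The reciprocal Gamma function vanishes at the nonpositive integers, so for \<open>n < 0\<close> the terms
  with \<open>k < - n\<close> drop out and this agrees with \<open>(-1) ^ \<bar>n\<bar>\<close> times the function of order \<open>\<bar>n\<bar>\<close>,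
  also at \<open>z = 0\<close>.
\<close>

definition bessel_J :: "int \<Rightarrow> complex \<Rightarrow> complex" where
  "bessel_J n z =
     (\<Sum>k. (-1) ^ k * rGamma (of_int (int k + n + 1)) / fact k * (z / 2) powi (2 * int k + n))"

definition fourier :: "(complex \<Rightarrow> complex) \<Rightarrow> complex \<Rightarrow> complex" where
  "fourier f \<xi> =
     set_lebesgue_integral lebesgue unit_disk
       (\<lambda>x. exp (- \<i> * complex_of_real (x \<bullet> \<xi>)) * f x)"

text \<open>On the unit circle, \<open>z powi l\<close> is \<open>exp (\<i> * l * \<theta>)\<close> for \<open>z = exp (\<i> * \<theta>)\<close>.\<close>

definition circle_e :: "int \<Rightarrow> complex \<Rightarrow> complex" where
  "circle_e l z = z powi l / complex_of_real (sqrt (2 * pi))"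

text \<open>Meaningful only if the denominator is nonzero. This is automatic for \<open>\<kappa> < 0\<close>; for \<open>\<kappa> > 0\<close> it
  excludes the Dirichlet eigenvalues of the disk.\<close>

definition phi :: "real \<Rightarrow> int \<Rightarrow> real \<Rightarrow> complex" where
  "phi \<kappa> l r =
     bessel_J \<bar>l\<bar> (csqrt (complex_of_real \<kappa>) * complex_of_real r) /
     bessel_J \<bar>l\<bar> (csqrt (complex_of_real \<kappa>))"

text \<open>On complex numbers, \<open>sgn x\<close> is \<open>x / \<bar>x\<bar>\<close> for \<open>x \<noteq> 0\<close>.\<close>

definition moment :: "real \<Rightarrow> int \<Rightarrow> int \<Rightarrow> (complex \<Rightarrow> complex) \<Rightarrow> complex" where
  "moment \<kappa> l m f =
     set_lebesgue_integral lebesgue unit_disk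
       (\<lambda>x. f x * phi \<kappa> l (cmod x) * phi \<kappa> m (cmod x) *
             cnj (circle_e l (sgn x)) * circle_e m (sgn x))"

definition series_term ::
    "real \<Rightarrow> (complex \<Rightarrow> complex) \<Rightarrow> complex \<Rightarrow> int \<Rightarrow> int \<Rightarrow> complex" where
  "series_term \<kappa> f \<zeta> l m =
     (let s = csqrt (complex_of_real \<kappa>); a = complex_of_real (cmod \<zeta>) in
       \<i> powi (l + m) *
       ((a + csqrt (a\<^sup>2 - complex_of_real \<kappa>)) / (a * s)) powi (l + m) *
       bessel_J l s * bessel_J m s * moment \<kappa> l m f * cnj \<zeta> powi l * \<zeta> powi m)"

end

theory Submission
  imports Defs
begin

text \<open>
  Put \<open>s = \<surd>\<kappa>\<close> and \<open>w = (|\<zeta>| + \<surd>(|\<zeta>|\<^sup>2 - \<kappa>)) / (|\<zeta>| s)\<close>. Then \<open>s (w + 1 / (w |\<zeta>|\<^sup>2)) = 2\<close>, so the kernel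
  \<open>exp (- i x \<bullet> \<xi>) = exp (i (\<zeta> x + cnj (\<zeta> x)))\<close> factors as the product of the Bessel generating functions
  \<open>exp ((s r / 2) (t - 1 / t))\<close> at \<open>t = i w cnj (\<zeta> e\<^sup>i\<^sup>\<theta>)\<close> and at \<open>t = i w \<zeta> e\<^sup>i\<^sup>\<theta>\<close>. The partial sums
  of the absolute values in these expansions are bounded uniformly on the disk, which permits termwise
  integration against \<open>f\<close>. Hence the moments determine the Fourier transform away from \<open>0\<close>, thus
  everywhere by continuity, and a compactly supported integrable function with vanishing Fourier
  transform is zero almost everywhere.
\<close>

section \<open>Products of absolutely convergent families and the exponential series\<close>

text \<open>Summing the norms row by row gives absolute summability on the product set, which in
  turn permits evaluating the double sum as an iterated one.\<close>

lemma has_sum_mult_Times: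
  fixes f :: "'a \<Rightarrow> 'c :: {real_normed_field, banach}" and g :: "'b \<Rightarrow> 'c"
  assumes f: "(\<lambda>x. norm (f x)) summable_on A" "(f has_sum S) A"
    and g: "(\<lambda>y. norm (g y)) summable_on B" "(g has_sum T) B"
  shows "(\<lambda>(x, y). norm (f x * g y)) summable_on A \<times> B"
    and "((\<lambda>(x, y). f x * g y) has_sum S * T) (A \<times> B)"
proof -
  define F where "F = (\<lambda>x. norm (f x) * (\<Sum>\<^sub>\<infinity>y\<in>B. norm (g y)))"
  have "(\<lambda>p. norm (f (fst p) * g (snd p))) summable_on A \<times> B"
  proof (rule summable_on_SigmaI[where g = F])
    show "((\<lambda>y. norm (f (fst (x, y)) * g (snd (x, y)))) has_sum F x) B" for x
      using g(1) by (auto simp: norm_mult F_def intro!: has_sum_cmult_right)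
    show "F summable_on A"
      unfolding F_def using f(1) by (rule summable_on_cmult_left)
  qed simp
  then show abs: "(\<lambda>(x, y). norm (f x * g y)) summable_on A \<times> B"
    by (simp add: case_prod_unfold)
  show "((\<lambda>(x, y). f x * g y) has_sum S * T) (A \<times> B)"
    by (rule has_sum_SigmaI[where g = "\<lambda>x. f x * T"])
      (use f g abs_summable_summable[of "\<lambda>(x, y). f x * g y" "A \<times> B"] abs in \<open>auto simp: case_prod_unfold intro!: has_sum_cmult_right has_sum_cmult_left\<close>)
qed

lemma exp_has_sum:
  fixes x :: "'a :: {real_normed_field, banach}"
  shows "(\<lambda>n. norm (x ^ n / fact n)) summable_on UNIV" "((\<lambda>n. x ^ n / fact n) has_sum exp x) UNIV"
proof -
  have eq: "x ^ n / fact n = x ^ n /\<^sub>R fact n" for n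
    by (simp add: scaleR_conv_of_real divide_inverse mult.commute)
  have sm: "summable (\<lambda>n. norm (x ^ n / fact n))"
    unfolding eq by (rule summable_norm_exp)
  show "((\<lambda>n. x ^ n / fact n) has_sum exp x) UNIV"
    by (rule norm_summable_imp_has_sum[OF sm]) (simp add: eq exp_converges)
  show "(\<lambda>n. norm (x ^ n / fact n)) summable_on UNIV"
    by (rule norm_summable_imp_summable_on) (use sm in simp)
qed

section \<open>Bessel functions of integer order\<close>

definition bessel_term :: "int \<Rightarrow> complex \<Rightarrow> nat \<Rightarrow> complex" where
  "bessel_term n z k =
     (-1) ^ k * rGamma (of_int (int k + n + 1)) / fact k * (z / 2) powi (2 * int k + n)"

lemma bessel_J_eq_suminf: "bessel_J n z = (\<Sum>k. bessel_term n z k)"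
  by (simp add: bessel_J_def bessel_term_def)

text \<open>Since \<open>2 * k + n = j + k\<close>, the term becomes symmetric in \<open>j\<close>
  and \<open>k\<close> up to sign, which is how it occurs in a product of two exponential
  series.\<close>

lemma bessel_term_eq:
  assumes "n + int k = int j"
  shows "bessel_term n z k = (-1) ^ k / (fact j * fact k) * (z / 2) ^ (j + k)"
proof -
  have "int k + n + 1 = int j + 1" "2 * int k + n = int (j + k)"
    using assms by auto
  then have "(z / 2) powi (2 * int k + n) = (z / 2) ^ (j + k)"
    and "rGamma (of_int (int k + n + 1)) = inverse (fact j :: complex)"
    using Gamma_fact[of j, where 'a = complex]
    by (simp_all only: power_int_of_nat) (simp add: rGamma_inverse_Gamma add.commute)
  then show ?thesis
    by (simp only: bessel_term_def) (simp add: field_simps)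
qed

text \<open>\<open>rGamma\<close> vanishes at nonpositive integers, so only indices with
  \<open>n + k \<ge> 0\<close> contribute.\<close>

lemma bessel_term_eq_0:
  assumes "n + int k < 0"
  shows "bessel_term n z k = 0"
proof -
  obtain m where "int k + n + 1 = - int m"
    by (rule that[of "nat (- (int k + n + 1))"]) (use assms in simp)
  then have "of_int (int k + n + 1) = (- of_nat m :: complex)"
    by simp
  then have "rGamma (of_int (int k + n + 1) :: complex) = 0"
    by (simp only: rGamma_eq_zero_iff minus_of_nat_in_nonpos_Ints)
  then show ?thesis
    by (simp add: bessel_term_def)
qed

text \<open>The change of index \<open>j = n + k\<close>: \<open>n\<close> is the resulting power of
  \<open>t\<close> and \<open>k\<close> the index in the series of the Bessel function. On this
  domain \<open>nat\<close> truncates nothing.\<close>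

lemma bij_betw_int_nat_pairs:
  "bij_betw (\<lambda>(n, k). (nat (n + int k), k)) (SIGMA n:UNIV. {k. 0 \<le> n + int k}) UNIV"
  by (rule bij_betw_byWitness[where f' = "\<lambda>(j, k). (int j - int k, k)"]) auto

text \<open>Multiply the exponential series of \<open>z * t / 2\<close> and \<open>- z / (2 * t)\<close> and collect the terms
  with the same power of \<open>t\<close>.\<close>

lemma bessel_J_generating_function:
  fixes z t :: complex
  assumes t: "t \<noteq> 0"
  shows bessel_term_has_sum: "(bessel_term n z has_sum bessel_J n z) UNIV"
    and bessel_J_has_sum: "((\<lambda>n. bessel_J n z * t powi n) has_sum exp (z / 2 * (t - 1 / t))) UNIV"
    and bessel_J_abs_summable: "(\<lambda>n. cmod (bessel_J n z * t powi n)) summable_on UNIV"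
    and bessel_J_finite_sum_le: "finite F \<Longrightarrow> (\<Sum>n\<in>F. cmod (bessel_J n z * t powi n)) \<le>
           exp (cmod z * (cmod t + 1 / cmod t) / 2)"
proof -
  define B where "B = (\<lambda>n. {k. 0 \<le> n + int k})"
  define x y where "x = z * t / 2" and "y = - z / (2 * t)"
  define e where "e = (\<lambda>(j, k). (x ^ j / fact j) * (y ^ k / fact k))"
  have e_term: "e (nat (n + int k), k) = bessel_term n z k * t powi n" if k: "k \<in> B n" for n k
  proof -
    obtain j where j: "n + int k = int j"
      using k unfolding B_def by (metis mem_Collect_eq nonneg_int_cases)
    then have "t powi n = t ^ j / t ^ k"
      using t by (metis add_diff_cancel_right' power_int_diff power_int_of_nat)
    moreover have "x ^ j = (z / 2) ^ j * t ^ j"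
      by (simp add: x_def power_mult_distrib power_divide)
    moreover have "y ^ k = (-1) ^ k * (z / 2) ^ k / t ^ k"
      using power_mult_distrib[of "-1" "z / 2 / t" k] by (simp add: y_def power_divide)
    ultimately show ?thesis
      using j by (simp add: bessel_term_eq[OF j] e_def power_add mult_ac)
  qed
  have abs_e: "(\<lambda>p. cmod (e p)) summable_on UNIV" and sum_e: "(e has_sum exp x * exp y) UNIV"
    using has_sum_mult_Times[OF exp_has_sum[of x] exp_has_sum[of y]] by (simp_all add: e_def case_prod_unfold)
  \<comment> \<open>The same product for the moduli gives the exact sum of the norms of
    \<open>e\<close>, which is the source of the explicit bound below.\<close>
  have "((\<lambda>(j, k). (cmod x ^ j / fact j) * (cmod y ^ k / fact k)) has_sum
      exp (cmod x) * exp (cmod y)) UNIV"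
    using has_sum_mult_Times[OF exp_has_sum[of "cmod x"] exp_has_sum[of "cmod y"]] by simp
  moreover have "(\<lambda>(j, k). (cmod x ^ j / fact j) * (cmod y ^ k / fact k)) = (\<lambda>p. cmod (e p))"
    by (auto simp: e_def norm_mult norm_divide norm_power fun_eq_iff)
  ultimately have sum_norm_e: "((\<lambda>p. cmod (e p)) has_sum exp (cmod x) * exp (cmod y)) UNIV"
    by simp
  note reindex = has_sum_reindex_bij_betw[OF bij_betw_int_nat_pairs, folded B_def]
  define T where "T = (\<lambda>(n, k). bessel_term n z k * t powi n)"
  have sum_T: "(T has_sum exp x * exp y) (SIGMA n:UNIV. B n)"
    using sum_e unfolding reindex[symmetric]
    by (rule has_sum_cong[THEN iffD1, rotated]) (auto simp: T_def e_term)
  have sum_norm_T: "((\<lambda>p. cmod (T p)) has_sum exp (cmod x) * exp (cmod y)) (SIGMA n:UNIV. B n)"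
    using sum_norm_e unfolding reindex[symmetric]
    by (rule has_sum_cong[THEN iffD1, rotated]) (auto simp: T_def e_term)
  then have abs_T: "(\<lambda>p. cmod (T p)) summable_on (SIGMA n:UNIV. B n)"
    by (rule has_sum_imp_summable)
  have abs_Tn: "(\<lambda>k. cmod (T (n, k))) summable_on B n" for n
    using summable_on_SigmaD1[of "\<lambda>n k. cmod (T (n, k))" UNIV B n] abs_T
    by (simp add: case_prod_unfold)
  have series: "(bessel_term n z has_sum bessel_J n z) UNIV"
    and Tn: "((\<lambda>k. T (n, k)) has_sum bessel_J n z * t powi n) (B n)" for n
  proof -
    \<comment> \<open>Convergence of the Bessel series itself is read off from the double series:
      divide the \<open>n\<close>-th row by the nonzero factor \<open>t powi n\<close>.\<close>
    have "(\<lambda>k. T (n, k) / t powi n) summable_on B n"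
      unfolding divide_inverse using abs_summable_summable[OF abs_Tn] by (rule summable_on_cmult_left)
    then have "bessel_term n z summable_on B n"
      using t by (simp add: T_def)
    then obtain S where S: "(bessel_term n z has_sum S) (B n)"
      using summable_on_def by blast
    then have S': "(bessel_term n z has_sum S) UNIV"
      by (rule has_sum_cong_neutral[THEN iffD1, rotated -1]) (auto simp: B_def bessel_term_eq_0)
    then have "S = bessel_J n z"
      by (simp add: bessel_J_eq_suminf has_sum_imp_sums sums_unique)
    with S S' show "(bessel_term n z has_sum bessel_J n z) UNIV"
      and "((\<lambda>k. T (n, k)) has_sum bessel_J n z * t powi n) (B n)"
      by (auto simp: T_def intro: has_sum_cmult_left)
  qed
  show "(bessel_term n z has_sum bessel_J n z) UNIV"
    by (rule series)
  have "x + y = z / 2 * (t - 1 / t)"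
    using t by (simp add: x_def y_def field_simps)
  then have exp_xy: "exp x * exp y = exp (z / 2 * (t - 1 / t))"
    by (simp only: exp_add[symmetric])
  show "((\<lambda>n. bessel_J n z * t powi n) has_sum exp (z / 2 * (t - 1 / t))) UNIV"
    using has_sum_SigmaD[OF sum_T Tn] unfolding exp_xy .
  \<comment> \<open>\<open>G n\<close> is the sum of the norms in row \<open>n\<close>. It dominates
    the \<open>n\<close>-th Laurent coefficient and has a known total, so it yields both absolute
    summability and the bound for finite sums.\<close>
  define G where "G = (\<lambda>n. \<Sum>\<^sub>\<infinity>k\<in>B n. cmod (T (n, k)))"
  have G: "(G has_sum exp (cmod x) * exp (cmod y)) UNIV"
    by (rule has_sum_SigmaD[OF sum_norm_T]) (use abs_Tn in \<open>simp add: G_def\<close>)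
  have G_ge: "cmod (bessel_J n z * t powi n) \<le> G n" for n
    unfolding G_def using norm_infsum_bound[OF abs_Tn] infsumI[OF Tn] by simp
  show "(\<lambda>n. cmod (bessel_J n z * t powi n)) summable_on UNIV"
    by (rule Infinite_Sum.abs_summable_on_comparison_test'[OF has_sum_imp_summable[OF G] G_ge])
  show "(\<Sum>n\<in>F. cmod (bessel_J n z * t powi n)) \<le>
      exp (cmod z * (cmod t + 1 / cmod t) / 2)" if F: "finite F"
  proof -
    have "(\<Sum>n\<in>F. cmod (bessel_J n z * t powi n)) \<le> sum G F"
      by (intro sum_mono G_ge)
    also have "\<dots> \<le> exp (cmod x) * exp (cmod y)"
      by (rule finite_sum_le_has_sum[OF G F]) (auto simp: G_def intro: infsum_nonneg)
    also have "\<dots> = exp (cmod z * (cmod t + 1 / cmod t) / 2)"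
      using t by (simp add: x_def y_def exp_add[symmetric] norm_mult norm_divide field_simps)
    finally show ?thesis .
  qed
qed

text \<open>The first \<open>n\<close> terms of order \<open>- n\<close> vanish, and shifting the
  index by \<open>n\<close> turns the others into those of order \<open>n\<close> times
  \<open>(-1) ^ n\<close>.\<close>

lemma bessel_J_minus: "bessel_J (- int n) z = (-1) ^ n * bessel_J (int n) z"
proof -
  \<comment> \<open>The instance \<open>1\<close> stands for the variable \<open>t\<close> of the
    generating function, which no longer occurs in this conclusion.\<close>
  have "((\<lambda>k. (-1) ^ n * bessel_term (int n) z k) has_sum (-1) ^ n * bessel_J (int n) z) UNIV"
    by (intro has_sum_cmult_right bessel_term_has_sum[of 1]) simp
  moreover have "(-1) ^ n * bessel_term (int n) z k = bessel_term (- int n) z (k + n)" for k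
    by (simp add: bessel_term_eq[of "int n" k "n + k"] bessel_term_eq[of "- int n" "k + n" k]
        power_add ac_simps)
  ultimately have "((\<lambda>k. bessel_term (- int n) z (k + n)) has_sum (-1) ^ n * bessel_J (int n) z) UNIV"
    by simp
  then have "(bessel_term (- int n) z has_sum (-1) ^ n * bessel_J (int n) z) {n..}"
    by (subst has_sum_reindex_bij_betw[symmetric, where g = "\<lambda>k. k + n" and A = UNIV])
      (auto intro!: bij_betw_byWitness[where f' = "\<lambda>k. k - n"])
  then have "(bessel_term (- int n) z has_sum (-1) ^ n * bessel_J (int n) z) UNIV"
    by (rule has_sum_cong_neutral[THEN iffD1, rotated -1]) (auto simp: bessel_term_eq_0)
  then show ?thesis
    using bessel_term_has_sum[of 1 "- int n" z] by (auto dest: has_sum_unique)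
qed

lemma bessel_J_abs: "bessel_J n z = (if n < 0 then (-1) ^ nat \<bar>n\<bar> else 1) * bessel_J \<bar>n\<bar> z"
  using bessel_J_minus[of "nat \<bar>n\<bar>" z] by (auto simp: not_less)

text \<open>On the imaginary axis all terms of the series of \<open>J\<^sub>n\<close> have the same argument.\<close>

lemma bessel_J_imaginary_nonzero:
  assumes y: "y > 0"
  shows "bessel_J (int n) (\<i> * complex_of_real y) \<noteq> 0"
proof -
  define c where "c = (\<lambda>k. (y / 2) ^ (2 * k) / (fact (n + k) * fact k))"
  let ?u = "(\<i> * complex_of_real y / 2) ^ n"
  have eq: "bessel_term (int n) (\<i> * complex_of_real y) k = ?u * complex_of_real (c k)" for k
  proof -
    \<comment> \<open>The square of \<open>\<i> ^ k\<close> is \<open>(-1) ^ k\<close>, which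
      cancels the alternating sign of the Bessel series and leaves the positive coefficient
      \<open>c k\<close>.\<close>
    have "(\<i> * complex_of_real y / 2) ^ k * (\<i> * complex_of_real y / 2) ^ k =
        (-1 * complex_of_real ((y / 2)\<^sup>2)) ^ k"
      by (simp only: power_mult_distrib[symmetric]) (simp add: power2_eq_square mult_ac)
    also have "\<dots> = (-1) ^ k * complex_of_real ((y / 2) ^ (2 * k))"
      by (simp only: power_mult_distrib power_mult of_real_power)
    finally have "bessel_term (int n) (\<i> * complex_of_real y) k = (-1) ^ k / (fact (n + k) * fact k) *
        (?u * ((-1) ^ k * complex_of_real ((y / 2) ^ (2 * k))))"
      by (subst bessel_term_eq[of _ _ "n + k"]) (simp_all add: power_add mult.assoc)
    also have "\<dots> = ((-1) ^ k * (-1) ^ k) * (?u * complex_of_real (c k))"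
      by (simp add: c_def)
    finally show ?thesis
      by (simp flip: power_mult_distrib)
  qed
  have "((\<lambda>k. ?u * complex_of_real (c k)) has_sum bessel_J (int n) (\<i> * complex_of_real y)) UNIV"
    unfolding eq[symmetric] by (rule bessel_term_has_sum[of 1]) simp
  then have "((\<lambda>k. complex_of_real (c k)) has_sum bessel_J (int n) (\<i> * complex_of_real y) / ?u) UNIV"
    using y by (subst (asm) has_sum_cmult_right_iff) auto
  then have "(c has_sum Re (bessel_J (int n) (\<i> * complex_of_real y) / ?u)) UNIV"
    using has_sum_Re by fastforce
  moreover have "c k > 0" for k
    using y by (simp add: c_def)
  ultimately have "sum c {0} \<le> Re (bessel_J (int n) (\<i> * complex_of_real y) / ?u)"
    by (intro finite_sum_le_has_sum) (auto intro: less_imp_le)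
  with \<open>c 0 > 0\<close> show ?thesis
    by auto
qed

text \<open>For a nonnegative order all exponents are natural numbers, so the function is a series
  of monomials. The absolute value matches the orders occurring in \<open>phi\<close>.\<close>

lemma bessel_J_measurable [measurable]:
  "bessel_J \<bar>n\<bar> \<in> borel_measurable borel"
proof -
  have "bessel_term (int m) z k = (-1) ^ k / (fact (m + k) * fact k) * (z / 2) ^ (m + k + k)" for m z k
    by (rule bessel_term_eq) simp
  then have "bessel_J (int m) =
      (\<lambda>z. \<Sum>k. (-1) ^ k / (fact (m + k) * fact k) * (z / 2) ^ (m + k + k))" for m
    by (simp add: bessel_J_eq_suminf fun_eq_iff)
  moreover have "(\<lambda>z :: complex. \<Sum>k. (-1) ^ k / (fact (m + k) * fact k) * (z / 2) ^ (m + k + k))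
      \<in> borel_measurable borel" for m
    by measurable
  ultimately show ?thesis
    by (metis abs_ge_zero nonneg_int_cases)
qed

section \<open>Uniqueness for Fourier transforms of compactly supported integrable functions\<close>

lemma sigma_finite_lebesgue: "sigma_finite_measure lebesgue"
proof
  obtain A where A: "countable A" "A \<subseteq> sets lborel" "\<Union> A = space (lborel :: 'a measure)"
    "\<forall>a\<in>A. emeasure lborel a \<noteq> \<infinity>"
    using lborel.sigma_finite_countable by blast
  show "\<exists>A. countable A \<and> A \<subseteq> sets lebesgue \<and> \<Union> A = space (lebesgue :: 'a measure) \<and>
      (\<forall>a\<in>A. emeasure lebesgue a \<noteq> \<infinity>)"
    by (rule exI[of _ A]) (use A in \<open>auto simp: emeasure_completion subset_iff main_part_sets\<close>)
qed

lemma borel_measurable_lebesgue_of_continuous: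
  "continuous_on UNIV g \<Longrightarrow> g \<in> borel_measurable lebesgue"
  by (intro measurable_completion) (simp add: borel_measurable_continuous_onI)

text \<open>Continuous multipliers approximate indicators of closed sets, increasing unions extend
  this to F-sigma sets, and every Lebesgue set is F-sigma up to a null set. An integrable function
  whose integral over every measurable set is 0 vanishes almost everywhere.\<close>

lemma AE_eq_0_if_integral_continuous_eq_0:
  fixes h :: "'a :: euclidean_space \<Rightarrow> 'b :: {banach, second_countable_topology}"
  assumes h: "integrable lebesgue h"
    and zero: "\<And>g :: 'a \<Rightarrow> real. continuous_on UNIV g \<Longrightarrow> (\<integral>x. g x *\<^sub>R h x \<partial>lebesgue) = 0"
  shows "AE x in lebesgue. h x = 0"
proof -
  have closed_0: "(\<integral>x. indicator C x *\<^sub>R h x \<partial>lebesgue) = 0" if C: "closed C" for C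
  proof (cases "C = {}")
    case False
    \<comment> \<open>The base is continuous, equals 1 on \<open>C\<close> and is below 1 off
      \<open>C\<close>, so its powers tend to the indicator. The empty set is treated apart because
      \<open>infdist x {}\<close> is 0 by convention.\<close>
    define g where "g = (\<lambda>n x. inverse (1 + infdist x C) ^ n)"
    have pos: "1 + infdist x C > 0" for x
      by (simp add: add_pos_nonneg infdist_nonneg)
    then have cont: "continuous_on UNIV (g n)" for n
      unfolding g_def by (intro continuous_intros) (simp add: less_imp_neq[symmetric])
    have g_le: "\<bar>g n x\<bar> \<le> 1" for n x
      using pos[of x] infdist_nonneg[of x C]
      by (auto simp: g_def power_abs abs_inverse intro!: power_le_one inverse_le_1_iff[THEN iffD2])
    have lim: "(\<lambda>n. g n x) \<longlonglongrightarrow> indicator C x" for x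
    proof (cases "x \<in> C")
      case False
      then have "infdist x C > 0"
        using C \<open>C \<noteq> {}\<close> infdist_nonneg[of x C] in_closed_iff_infdist_zero[of C x] by linarith
      then show ?thesis
        using False pos[of x] unfolding g_def
        by (auto intro!: LIMSEQ_power_zero simp: inverse_less_1_iff)
    qed (simp add: g_def)
    have "(\<lambda>n. \<integral>x. g n x *\<^sub>R h x \<partial>lebesgue) \<longlonglongrightarrow> (\<integral>x. indicator C x *\<^sub>R h x \<partial>lebesgue)"
    proof (rule integral_dominated_convergence[where w = "\<lambda>x. norm (h x)"])
      show "(\<lambda>x. indicator C x *\<^sub>R h x) \<in> borel_measurable lebesgue"
        using h C by (intro borel_measurable_scaleR borel_measurable_indicator) auto
      show "(\<lambda>x. g n x *\<^sub>R h x) \<in> borel_measurable lebesgue" for n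
        using h borel_measurable_lebesgue_of_continuous[OF cont[of n]]
        by (intro borel_measurable_scaleR) auto
      show "AE x in lebesgue. norm (g n x *\<^sub>R h x) \<le> norm (h x)" for n
        using g_le by (auto intro!: AE_I2 mult_left_le_one_le)
    qed (use h lim in \<open>auto intro!: tendsto_scaleR\<close>)
    then show ?thesis
      using zero[OF cont] by (simp add: LIMSEQ_const_iff)
  qed simp
  have "set_lebesgue_integral lebesgue A h = 0" if A: "A \<in> sets lebesgue" for A
  proof -
    obtain C T where C: "fsigma C" and T: "T \<in> null_sets lebesgue" and CT: "C \<union> T = A"
      using lebesgue_set_almost_fsigma[OF A] by metis
    obtain F :: "nat \<Rightarrow> 'a set" where F: "\<And>n. closed (F n)" and C_eq: "C = \<Union>(range F)"
      using C by (auto elim: fsigma.cases)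
    \<comment> \<open>Finite unions stay closed, so \<open>closed_0\<close> applies to them, and
      they increase to \<open>C\<close>.\<close>
    define F' where "F' = (\<lambda>n. \<Union>i<n. F i)"
    have F': "closed (F' n)" for n
      unfolding F'_def using F by auto
    have [measurable]: "C \<in> sets lebesgue"
      unfolding C_eq using F by auto
    have "(\<lambda>n. \<integral>x. indicator (F' n) x *\<^sub>R h x \<partial>lebesgue) \<longlonglongrightarrow> (\<integral>x. indicator C x *\<^sub>R h x \<partial>lebesgue)"
    proof (rule integral_dominated_convergence[where w = "\<lambda>x. norm (h x)"])
      show "(\<lambda>x. indicator C x *\<^sub>R h x) \<in> borel_measurable lebesgue"
        using h by measurable
      show "(\<lambda>x. indicator (F' n) x *\<^sub>R h x) \<in> borel_measurable lebesgue" for n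
        using h F'[of n] by (intro borel_measurable_scaleR borel_measurable_indicator) auto
      show "AE x in lebesgue. (\<lambda>n. indicator (F' n) x *\<^sub>R h x) \<longlonglongrightarrow> indicator C x *\<^sub>R h x"
      proof (rule AE_I2)
        fix x
        have "(\<lambda>n. indicator (F' n) x :: real) \<longlonglongrightarrow> indicator C x"
          using LIMSEQ_indicator_UN[of F x] by (simp add: F'_def C_eq)
        then show "(\<lambda>n. indicator (F' n) x *\<^sub>R h x) \<longlonglongrightarrow> indicator C x *\<^sub>R h x"
          by (intro tendsto_scaleR) auto
      qed
    qed (use h in \<open>auto simp: indicator_def\<close>)
    then have "(\<integral>x. indicator C x *\<^sub>R h x \<partial>lebesgue) = 0"
      using closed_0[OF F'] by (simp add: LIMSEQ_const_iff)
    moreover have "(\<integral>x. indicator A x *\<^sub>R h x \<partial>lebesgue) = (\<integral>x. indicator C x *\<^sub>R h x \<partial>lebesgue)"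
    proof (rule integral_cong_AE)
      show "AE x in lebesgue. indicator A x *\<^sub>R h x = indicator C x *\<^sub>R h x"
        using AE_not_in[OF T] by eventually_elim (auto simp: indicator_def CT[symmetric])
    qed (use h A in \<open>measurable\<close>)
    ultimately show ?thesis
      by (simp add: set_lebesgue_integral_def)
  qed
  then show ?thesis
    using sigma_finite_measure.density_zero[OF sigma_finite_lebesgue h] by blast
qed

text \<open>The continuous multipliers that preserve vanishing of the Fourier transform form a ring
  containing the cosines and sines, which is dense by the Stone-Weierstrass theorem.\<close>

lemma fourier_integral_injective:
  fixes h :: "'a :: euclidean_space \<Rightarrow> complex"
  assumes h: "integrable lebesgue h" and K: "compact K" and supp: "\<And>x. x \<notin> K \<Longrightarrow> h x = 0"
    and zero: "\<And>\<xi>. \<xi> \<noteq> 0 \<Longrightarrow> (\<integral>x. exp (- \<i> * complex_of_real (x \<bullet> \<xi>)) * h x \<partial>lebesgue) = 0"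
  shows "AE x in lebesgue. h x = 0"
proof (rule AE_eq_0_if_integral_continuous_eq_0[OF h])
  define E :: "'a \<Rightarrow> 'a \<Rightarrow> complex" where "E = (\<lambda>\<xi> x. exp (- \<i> * complex_of_real (x \<bullet> \<xi>)))"
  define P where "P = (\<lambda>k. integrable lebesgue k \<and> (\<forall>\<xi>. (\<integral>x. E \<xi> x * k x \<partial>lebesgue) = 0))"
  \<comment> \<open>Quantifying over all \<open>k\<close> with \<open>P k\<close>, rather than
    fixing \<open>h\<close>, makes closure under products a matter of composing two
    multiplications.\<close>
  define R where "R = (\<lambda>g. continuous_on UNIV g \<and> (\<forall>k. P k \<longrightarrow> P (\<lambda>x. complex_of_real (g x) * k x)))"
  have E_meas: "E \<xi> \<in> borel_measurable lebesgue" for \<xi>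
    unfolding E_def by (intro borel_measurable_lebesgue_of_continuous continuous_intros)
  have norm_E: "cmod (E \<xi> x) = 1" for \<xi> x
    by (simp add: E_def)
  have int_bounded: "integrable lebesgue (\<lambda>x. u x * k x)"
    if "integrable lebesgue k" "u \<in> borel_measurable lebesgue" "\<And>x. cmod (u x) \<le> 1"
    for u k :: "'a \<Rightarrow> complex"
    by (rule Bochner_Integration.integrable_bound[OF that(1)])
      (use that in \<open>auto simp: norm_mult intro!: mult_left_le_one_le\<close>)
  have int_E: "integrable lebesgue (\<lambda>x. E \<xi> x * k x)" if "integrable lebesgue k" for \<xi> k
    using that E_meas by (rule int_bounded) (simp add: norm_E)
  have Ph: "P h"
    unfolding P_def
  proof (intro conjI allI h)
    fix \<xi>
    show "(\<integral>x. E \<xi> x * h x \<partial>lebesgue) = 0"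
    proof (cases "\<xi> = 0")
      case True
      obtain b :: 'a where b: "b \<in> Basis"
        using nonempty_Basis by blast
      \<comment> \<open>The assumption is silent at frequency 0, so that value is recovered as a
        limit along nonzero frequencies, with dominating function \<open>cmod (h x)\<close>.\<close>
      have "(\<lambda>n. \<integral>x. E ((1 / real (Suc n)) *\<^sub>R b) x * h x \<partial>lebesgue) \<longlonglongrightarrow> (\<integral>x. E \<xi> x * h x \<partial>lebesgue)"
      proof (rule integral_dominated_convergence[where w = "\<lambda>x. cmod (h x)"])
        show "AE x in lebesgue. (\<lambda>n. E ((1 / real (Suc n)) *\<^sub>R b) x * h x) \<longlonglongrightarrow> E \<xi> x * h x"
        proof (rule AE_I2)
          fix x
          have "(\<lambda>n. E ((1 / real (Suc n)) *\<^sub>R b) x) \<longlonglongrightarrow> E (0 *\<^sub>R b) x"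
            unfolding E_def by (intro tendsto_intros LIMSEQ_Suc lim_1_over_n)
          then show "(\<lambda>n. E ((1 / real (Suc n)) *\<^sub>R b) x * h x) \<longlonglongrightarrow> E \<xi> x * h x"
            using True by (intro tendsto_intros) simp
        qed
      qed (use h int_E norm_E in \<open>auto simp: norm_mult\<close>)
      moreover have "(\<integral>x. E ((1 / real (Suc n)) *\<^sub>R b) x * h x \<partial>lebesgue) = 0" for n
        unfolding E_def using b by (intro zero) auto
      ultimately show ?thesis
        by (simp add: LIMSEQ_const_iff)
    qed (use zero in \<open>simp add: E_def\<close>)
  qed
  have E_add: "E (\<xi> + \<eta>) x = E \<xi> x * E \<eta> x" for \<xi> \<eta> x
    by (simp add: E_def inner_add_right distrib_left exp_add[symmetric])
  have R_trig: "R c"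
    if c: "\<And>x. complex_of_real (c x) = p * E \<eta> x + q * E (- \<eta>) x" and "continuous_on UNIV c"
      and "\<And>x. \<bar>c x\<bar> \<le> 1"
    for c \<eta> p q
    unfolding R_def
  proof (intro conjI allI impI)
    fix k assume k: "P k"
    \<comment> \<open>Multiplication by \<open>c\<close> shifts frequencies by \<open>\<eta>\<close>
      and \<open>- \<eta>\<close>. This is why \<open>P\<close> asks for vanishing at every
      frequency, 0 included.\<close>
    have mult: "E \<xi> x * (complex_of_real (c x) * k x) =
        p * (E (\<xi> + \<eta>) x * k x) + q * (E (\<xi> - \<eta>) x * k x)" for \<xi> x
      using E_add[of \<xi> \<eta> x] E_add[of \<xi> "- \<eta>" x] by (simp add: c distrib_left distrib_right mult_ac)
    have "(\<lambda>x. complex_of_real (c x)) \<in> borel_measurable lebesgue"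
      by (intro borel_measurable_lebesgue_of_continuous continuous_intros) fact
    then have "integrable lebesgue (\<lambda>x. complex_of_real (c x) * k x)"
      using k \<open>\<And>x. \<bar>c x\<bar> \<le> 1\<close> by (intro int_bounded) (simp_all add: P_def del: c)
    then show "P (\<lambda>x. complex_of_real (c x) * k x)"
      using k int_E unfolding P_def mult by simp
  qed fact
  have R_cos: "R (\<lambda>x. cos (x \<bullet> \<eta>))" for \<eta>
  proof (rule R_trig)
    show "complex_of_real (cos (x \<bullet> \<eta>)) = 1 / 2 * E \<eta> x + 1 / 2 * E (- \<eta>) x" for x
      unfolding cos_of_real[symmetric] cos_exp_eq by (simp add: E_def field_simps)
  qed (auto intro!: continuous_intros)
  have R_sin: "R (\<lambda>x. sin (x \<bullet> \<eta>))" for \<eta>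
  proof (rule R_trig)
    show "complex_of_real (sin (x \<bullet> \<eta>)) = \<i> / 2 * E \<eta> x + (- \<i> / 2) * E (- \<eta>) x" for x
      unfolding sin_of_real[symmetric] sin_exp_eq by (simp add: E_def field_simps)
  qed (auto intro!: continuous_intros)
  have R_const: "R (\<lambda>_. c)" for c
    unfolding R_def P_def by (auto simp: mult.left_commute)
  have R_add: "R (\<lambda>x. f x + g x)" if "R f \<and> R g" for f g
    using that int_E unfolding R_def P_def
    by (auto simp: distrib_right distrib_left intro!: continuous_intros)
  have R_mult: "R (\<lambda>x. f x * g x)" if "R f \<and> R g" for f g
  proof -
    have "P (\<lambda>x. complex_of_real (f x) * (complex_of_real (g x) * k x))" if "P k" for k
      using that \<open>R f \<and> R g\<close> unfolding R_def by blast
    then show ?thesis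
      using that unfolding R_def by (auto simp: mult.assoc intro!: continuous_intros)
  qed
  have R_sep: "\<exists>f. R f \<and> f x \<noteq> f y" if xy: "x \<noteq> y" for x y
  proof -
    \<comment> \<open>Scaled so that the phases at \<open>x\<close> and \<open>y\<close> differ by
      \<open>pi\<close>: cosine and sine both change sign, and since they cannot both be 0, one of
      them separates the points.\<close>
    define \<eta> where "\<eta> = (pi / ((x - y) \<bullet> (x - y))) *\<^sub>R (x - y)"
    have "(x - y) \<bullet> \<eta> = pi"
      using xy by (simp add: \<eta>_def)
    then have "x \<bullet> \<eta> = y \<bullet> \<eta> + pi"
      by (simp add: inner_diff_left)
    then have "cos (x \<bullet> \<eta>) = - cos (y \<bullet> \<eta>)" "sin (x \<bullet> \<eta>) = - sin (y \<bullet> \<eta>)"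
      by simp_all
    then have "cos (x \<bullet> \<eta>) \<noteq> cos (y \<bullet> \<eta>) \<or> sin (x \<bullet> \<eta>) \<noteq> sin (y \<bullet> \<eta>)"
      using sin_zero_abs_cos_one[of "y \<bullet> \<eta>"] by auto
    then show ?thesis
      using R_cos R_sin by metis
  qed
  have R_0: "(\<integral>x. g x *\<^sub>R h x \<partial>lebesgue) = 0" and R_int: "integrable lebesgue (\<lambda>x. g x *\<^sub>R h x)"
    if "R g" for g
  proof -
    have *: "P (\<lambda>x. g x *\<^sub>R h x)"
      using that Ph unfolding R_def by (simp add: scaleR_conv_of_real)
    then show "integrable lebesgue (\<lambda>x. g x *\<^sub>R h x)"
      unfolding P_def by blast
    from * have "(\<integral>x. E 0 x * (g x *\<^sub>R h x) \<partial>lebesgue) = 0"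
      unfolding P_def by blast
    then show "(\<integral>x. g x *\<^sub>R h x \<partial>lebesgue) = 0"
      by (simp add: E_def)
  qed
  fix g :: "'a \<Rightarrow> real"
  assume g: "continuous_on UNIV g"
  have approx: "norm (\<integral>x. g x *\<^sub>R h x \<partial>lebesgue) \<le> e * (\<integral>x. norm (h x) \<partial>lebesgue)"
    if e: "e > 0" for e
  proof -
    have "\<exists>f. R f \<and> (\<forall>x\<in>K. \<bar>g x - f x\<bar> < e)"
    proof (rule Stone_Weierstrass_HOL[OF K R_const _ R_add R_mult])
      show "continuous_on K f" if "R f" for f
        using that continuous_on_subset unfolding R_def by blast
      show "continuous_on K g"
        using g continuous_on_subset by blast
    qed (use R_sep e in auto)
    then obtain f where f: "R f" "\<And>x. x \<in> K \<Longrightarrow> \<bar>g x - f x\<bar> < e"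
      by blast
    \<comment> \<open>Off \<open>K\<close> both sides are 0 because \<open>h\<close> vanishes there,
      so approximating \<open>g\<close> uniformly on \<open>K\<close> is enough.\<close>
    have le: "norm (g x *\<^sub>R h x - f x *\<^sub>R h x) \<le> e * norm (h x)" for x
      using f(2)[of x] supp[of x]
      by (cases "x \<in> K") (auto simp flip: scaleR_diff_left intro!: mult_right_mono)
    have int: "integrable lebesgue (\<lambda>x. g x *\<^sub>R h x - f x *\<^sub>R h x)"
    proof (rule Bochner_Integration.integrable_bound)
      show "integrable lebesgue (\<lambda>x. e * norm (h x))"
        using h by simp
      show "(\<lambda>x. g x *\<^sub>R h x - f x *\<^sub>R h x) \<in> borel_measurable lebesgue"
        using h borel_measurable_lebesgue_of_continuous[OF g]
        by (intro borel_measurable_diff[OF borel_measurable_scaleR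
              borel_measurable_integrable[OF R_int[OF f(1)]]]) auto
      show "AE x in lebesgue. norm (g x *\<^sub>R h x - f x *\<^sub>R h x) \<le> norm (e * norm (h x))"
        using le e by (intro AE_I2) (simp add: abs_mult)
    qed
    have "(\<integral>x. g x *\<^sub>R h x \<partial>lebesgue) =
        (\<integral>x. (g x *\<^sub>R h x - f x *\<^sub>R h x) + f x *\<^sub>R h x \<partial>lebesgue)"
      by simp
    also have "\<dots> = (\<integral>x. g x *\<^sub>R h x - f x *\<^sub>R h x \<partial>lebesgue)"
      by (subst Bochner_Integration.integral_add[OF int R_int[OF f(1)]]) (simp add: R_0[OF f(1)])
    also have "norm \<dots> \<le> (\<integral>x. e * norm (h x) \<partial>lebesgue)"
      by (rule Bochner_Integration.integral_norm_bound_integral) (use int h le in auto)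
    finally show ?thesis
      by simp
  qed
  show "(\<integral>x. g x *\<^sub>R h x \<partial>lebesgue) = 0"
  proof (rule ccontr)
    define N where "N = norm (\<integral>x. g x *\<^sub>R h x \<partial>lebesgue)"
    define H where "H = (\<integral>x. norm (h x) \<partial>lebesgue)"
    assume "(\<integral>x. g x *\<^sub>R h x \<partial>lebesgue) \<noteq> 0"
    then have N: "N > 0"
      by (simp add: N_def)
    have H: "H \<ge> 0"
      by (simp add: H_def)
    \<comment> \<open>With this accuracy the estimate reads
      \<open>N \<le> N * H / (H + 1) < N\<close>; the summand 1 also covers
      \<open>H = 0\<close>.\<close>
    have "N / (H + 1) > 0"
      using N H by simp
    then have "N \<le> N / (H + 1) * H"
      unfolding N_def H_def by (rule approx)
    then show False
      using N H by (simp add: field_simps)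
  qed
qed

section \<open>Termwise integration of countable families\<close>

text \<open>Integrating the bound on finite sums of norms shows that the integrals of the norms are
  summable. Termwise integration of sequences then applies once the index type is embedded into the
  naturals.\<close>

lemma has_sum_integral:
  fixes g :: "'i :: countable \<Rightarrow> 'a \<Rightarrow> 'b :: {banach, second_countable_topology}"
  assumes g: "\<And>i. integrable M (g i)" and B: "integrable M B"
    and bound: "AE x in M. \<forall>F. finite F \<longrightarrow> (\<Sum>i\<in>F. norm (g i x)) \<le> B x"
    and sum: "AE x in M. ((\<lambda>i. g i x) has_sum S x) UNIV" and S: "S \<in> borel_measurable M"
  shows "(\<lambda>i. norm (integral\<^sup>L M (g i))) summable_on UNIV"
    and "((\<lambda>i. integral\<^sup>L M (g i)) has_sum integral\<^sup>L M S) UNIV"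
proof -
  \<comment> \<open>\<open>to_nat\<close> need not be surjective; the value 0 outside its range
    leaves unordered sums unchanged.\<close>
  define ext :: "('i \<Rightarrow> 'b) \<Rightarrow> nat \<Rightarrow> 'b"
    where "ext = (\<lambda>c n. if n \<in> range (to_nat :: 'i \<Rightarrow> nat) then c (from_nat n) else 0)"
  have ext: "(ext c has_sum V) UNIV \<longleftrightarrow> (c has_sum V) UNIV" for c V
  proof -
    have "(ext c has_sum V) UNIV \<longleftrightarrow> (ext c has_sum V) (range (to_nat :: 'i \<Rightarrow> nat))"
      by (rule has_sum_cong_neutral) (auto simp: ext_def)
    also have "\<dots> \<longleftrightarrow> ((\<lambda>i :: 'i. ext c (to_nat i)) has_sum V) UNIV"
      by (rule has_sum_reindex_bij_betw[symmetric, where g = to_nat]) (simp add: bij_betw_def)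
    also have "(\<lambda>i :: 'i. ext c (to_nat i)) = c"
      by (simp add: ext_def)
    finally show ?thesis .
  qed
  have norm_ext: "summable (\<lambda>n. norm (ext c n))" if "(\<lambda>i. norm (c i)) summable_on UNIV" for c
  proof -
    have "(\<lambda>n. norm (ext c n)) summable_on range (to_nat :: 'i \<Rightarrow> nat)"
      by (subst summable_on_reindex) (use that in \<open>auto simp: ext_def o_def\<close>)
    then have "(\<lambda>n. norm (ext c n)) summable_on UNIV"
      by (rule summable_on_cong_neutral[THEN iffD1, rotated -1]) (auto simp: ext_def)
    then show ?thesis
      by (rule summable_on_imp_summable)
  qed
  have norm_sum: "(\<lambda>i. \<integral>x. norm (g i x) \<partial>M) summable_on UNIV"
  proof (rule nonneg_bdd_above_summable_on)
    have "(\<Sum>i\<in>F. \<integral>x. norm (g i x) \<partial>M) \<le> integral\<^sup>L M B" if "finite F" for F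
    proof -
      have "(\<Sum>i\<in>F. \<integral>x. norm (g i x) \<partial>M) = (\<integral>x. (\<Sum>i\<in>F. norm (g i x)) \<partial>M)"
        using g by (intro Bochner_Integration.integral_sum[symmetric]) simp
      also have "\<dots> \<le> integral\<^sup>L M B"
        using g B bound that by (intro integral_mono_AE) auto
      finally show ?thesis .
    qed
    then show "bdd_above (sum (\<lambda>i. \<integral>x. norm (g i x) \<partial>M) ` {F. F \<subseteq> UNIV \<and> finite F})"
      by (intro bdd_aboveI2) auto
  qed simp
  show norm_int: "(\<lambda>i. norm (integral\<^sup>L M (g i))) summable_on UNIV"
    by (rule Infinite_Sum.abs_summable_on_comparison_test'[OF norm_sum integral_norm_bound])
  then have "(\<lambda>i. integral\<^sup>L M (g i)) summable_on UNIV"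
    by (rule abs_summable_summable)
  \<comment> \<open>\<open>V\<close> exists by absolute summability. It is identified with the
    integral of \<open>S\<close> through the sequence \<open>f\<close>, whose series of integrals
    has both values as its sum.\<close>
  then obtain V where V: "((\<lambda>i. integral\<^sup>L M (g i)) has_sum V) UNIV"
    unfolding summable_on_def ..
  define f where "f = (\<lambda>n x. ext (\<lambda>i. g i x) n)"
  have int_f: "integral\<^sup>L M (f n) = ext (\<lambda>i. integral\<^sup>L M (g i)) n"
    and int_norm_f: "(\<integral>x. norm (f n x) \<partial>M) = (if n \<in> range (to_nat :: 'i \<Rightarrow> nat)
        then (\<integral>x. norm (g (from_nat n) x) \<partial>M) else 0)" for n
    by (auto simp: f_def ext_def)
  have "(\<lambda>n. integral\<^sup>L M (f n)) sums (\<integral>x. (\<Sum>n. f n x) \<partial>M)"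
  proof (rule sums_integral)
    show "integrable M (f n)" for n
      using g by (cases "n \<in> range (to_nat :: 'i \<Rightarrow> nat)") (auto simp: f_def ext_def)
    show "AE x in M. summable (\<lambda>n. norm (f n x))"
      using bound
    proof eventually_elim
      case (elim x)
      then have "(\<lambda>i. norm (g i x)) summable_on UNIV"
        by (intro nonneg_bdd_above_summable_on) (auto intro!: bdd_aboveI2[where M = "B x"])
      then show ?case
        unfolding f_def by (rule norm_ext)
    qed
    have "(\<lambda>n. \<integral>x. norm (f n x) \<partial>M) summable_on range (to_nat :: 'i \<Rightarrow> nat)"
      by (subst summable_on_reindex) (use norm_sum in \<open>auto simp: int_norm_f o_def\<close>)
    then have "(\<lambda>n. \<integral>x. norm (f n x) \<partial>M) summable_on UNIV"
      by (rule summable_on_cong_neutral[THEN iffD1, rotated -1]) (auto simp: int_norm_f)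
    then show "summable (\<lambda>n. \<integral>x. norm (f n x) \<partial>M)"
      by (rule summable_on_imp_summable)
  qed
  moreover have "(\<lambda>n. integral\<^sup>L M (f n)) sums V"
    using V unfolding int_f by (intro has_sum_imp_sums) (simp add: ext)
  ultimately have "V = (\<integral>x. (\<Sum>n. f n x) \<partial>M)"
    by (metis sums_unique2)
  also have "\<dots> = integral\<^sup>L M S"
  proof (rule integral_cong_AE[OF _ S])
    have [measurable]: "f n \<in> borel_measurable M" for n
      using g by (cases "n \<in> range (to_nat :: 'i \<Rightarrow> nat)") (auto simp: f_def ext_def)
    show "(\<lambda>x. \<Sum>n. f n x) \<in> borel_measurable M"
      by measurable
    show "AE x in M. (\<Sum>n. f n x) = S x"
      using sum
    proof eventually_elim
      case (elim x)
      then have "(\<lambda>n. f n x) sums S x"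
        unfolding f_def by (intro has_sum_imp_sums) (simp add: ext)
      then show ?case
        by (rule sums_unique[symmetric])
    qed
  qed
  finally show "((\<lambda>i. integral\<^sup>L M (g i)) has_sum integral\<^sup>L M S) UNIV"
    using V by simp
qed

section \<open>Expansion of the Fourier kernel and integration against \<open>f\<close>\<close>

lemma power_int_measurable [measurable]:
  "(\<lambda>z :: complex. z powi l) \<in> borel_measurable borel"
  unfolding power_int_def by measurable

lemma phi_measurable: "(\<lambda>x. phi \<kappa> l (cmod x)) \<in> borel_measurable borel"
  unfolding phi_def by measurable

lemma circle_e_sgn_measurable: "(\<lambda>x. circle_e l (sgn x)) \<in> borel_measurable borel"
proof -
  have "(\<lambda>x. (x /\<^sub>R cmod x) powi l) \<in> borel_measurable borel"
    by measurable
  then show ?thesis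
    unfolding circle_e_def sgn_div_norm by measurable
qed

text \<open>The bound is imposed on the product, so \<open>q\<close> has to be controlled only where
  \<open>F\<close> is nonzero, which for a function extended by zero means inside the disk.\<close>

lemma integrable_mult_bounded_AE:
  fixes q F :: "'a \<Rightarrow> complex"
  assumes "integrable M F" "q \<in> borel_measurable M" "AE x in M. cmod (F x * q x) \<le> C * cmod (F x)"
  shows "integrable M (\<lambda>x. F x * q x)"
proof (rule Bochner_Integration.integrable_bound)
  show "integrable M (\<lambda>x. C * cmod (F x))"
    using assms(1) by simp
  show "AE x in M. cmod (F x * q x) \<le> norm (C * cmod (F x))"
    using assms(3) by eventually_elim auto
qed (use assms in auto)

text \<open>Because \<open>(a + b) * (a - b) = s\<^sup>2\<close>, the reciprocal term equals
  \<open>(a - b) / (a * s)\<close>, and adding \<open>(a + b) / (a * s)\<close> leaves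
  \<open>2 / s\<close>. It is used with \<open>a = |\<zeta>|\<close>, \<open>s\<close> the root of
  \<open>\<kappa>\<close> and \<open>b\<close> the root of
  \<open>a\<^sup>2 - \<kappa>\<close>.\<close>

lemma spectral_parameter_identity:
  fixes a s b :: complex
  assumes "b\<^sup>2 = a\<^sup>2 - s\<^sup>2" "s \<noteq> 0" "a \<noteq> 0"
  shows "(a + b) / (a * s) \<noteq> 0" and "s / 2 * ((a + b) / (a * s) + 1 / ((a + b) / (a * s) * a\<^sup>2)) = 1"
proof -
  have prod: "(a + b) * (a - b) = s\<^sup>2"
    using assms(1) by (simp add: power2_eq_square algebra_simps)
  then have ab: "a + b \<noteq> 0"
    using assms by auto
  then show "(a + b) / (a * s) \<noteq> 0"
    using assms by simp
  have "(a + b) / (a * s) * a\<^sup>2 = a * (a + b) / s"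
    using assms by (simp add: power2_eq_square)
  then have "1 / ((a + b) / (a * s) * a\<^sup>2) = s / (a * (a + b))"
    by simp
  also have "\<dots> = s\<^sup>2 / (s * (a * (a + b)))"
    using assms ab by (simp add: power2_eq_square)
  also have "\<dots> = (a + b) * (a - b) / ((a + b) * (a * s))"
    unfolding prod by (simp only: mult_ac)
  also have "\<dots> = (a - b) / (a * s)"
    using ab by (rule mult_divide_mult_cancel_left)
  finally show "s / 2 * ((a + b) / (a * s) + 1 / ((a + b) / (a * s) * a\<^sup>2)) = 1"
    using assms by (simp add: add_divide_distrib[symmetric])
qed

lemma bessel_J_sqrt_nonzero:
  assumes "\<kappa> < 0"
  shows "bessel_J \<bar>l\<bar> (csqrt (complex_of_real \<kappa>)) \<noteq> 0"
proof -
  have "csqrt (complex_of_real \<kappa>) = \<i> * complex_of_real (sqrt (- \<kappa>))"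
    using assms by (simp add: csqrt_of_real_nonpos)
  then show ?thesis
    using bessel_J_imaginary_nonzero[of "sqrt (- \<kappa>)" "nat \<bar>l\<bar>"] assms by simp
qed

text \<open>Passing from order \<open>l\<close> to \<open>\<bar>l\<bar>\<close> produces the same
  sign at both arguments, so the denominator of \<open>phi\<close> cancels.\<close>

lemma bessel_J_mult_phi:
  assumes "bessel_J \<bar>l\<bar> (csqrt (complex_of_real \<kappa>)) \<noteq> 0"
  shows "bessel_J l (csqrt (complex_of_real \<kappa>)) * phi \<kappa> l r =
    bessel_J l (csqrt (complex_of_real \<kappa>) * complex_of_real r)"
  unfolding phi_def by (subst (1 4) bessel_J_abs) (use assms in auto)

text \<open>The kernel expansion, multiplied by the extension \<open>h\<close> of \<open>f\<close>
  by zero, is integrated term by term with dominating function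
  \<open>C * C * cmod (h x)\<close>.\<close>

lemma fourier_has_sum:
  fixes \<kappa> :: real and f :: "complex \<Rightarrow> complex" and \<xi> \<zeta> :: complex
  assumes \<kappa>: "\<kappa> \<noteq> 0"
    and J: "\<And>l. bessel_J \<bar>l\<bar> (csqrt (complex_of_real \<kappa>)) \<noteq> 0"
    and f: "f absolutely_integrable_on unit_disk" and \<xi>: "\<xi> \<noteq> 0"
    and \<zeta>: "\<zeta> = - (complex_of_real (Re \<xi>) - \<i> * complex_of_real (Im \<xi>)) / 2"
  shows "(\<lambda>(l, m). cmod (2 * complex_of_real pi * series_term \<kappa> f \<zeta> l m)) summable_on UNIV"
    and "((\<lambda>(l, m). 2 * complex_of_real pi * series_term \<kappa> f \<zeta> l m) has_sum fourier f \<xi>) UNIV"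
proof -
  define s where "s = csqrt (complex_of_real \<kappa>)"
  define a where "a = complex_of_real (cmod \<zeta>)"
  define w where "w = (a + csqrt (a\<^sup>2 - complex_of_real \<kappa>)) / (a * s)"
  define T U where "T = \<i> * w * cnj \<zeta>" and "U = \<i> * w * \<zeta>"
  define h where "h = (\<lambda>x. indicator unit_disk x *\<^sub>R f x)"
  \<comment> \<open>All constants of the series term are moved under the integral, so that
    \<open>h x * q (l, m) x\<close> integrates to \<open>2 * pi\<close> times that term.\<close>
  define q where "q = (\<lambda>(l, m) x. 2 * complex_of_real pi * \<i> powi (l + m) * w powi (l + m) *
    bessel_J l s * bessel_J m s * cnj \<zeta> powi l * \<zeta> powi m *
    (phi \<kappa> l (cmod x) * phi \<kappa> m (cmod x) * cnj (circle_e l (sgn x)) * circle_e m (sgn x)))"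
  define e where "e = (\<lambda>x. exp (- \<i> * complex_of_real (x \<bullet> \<xi>)))"
  have \<zeta>_cnj: "\<zeta> = - cnj \<xi> / 2"
    unfolding \<zeta> by (simp add: complex_eq_iff)
  then have \<zeta>0: "\<zeta> \<noteq> 0"
    using \<xi> by simp
  have s2: "s\<^sup>2 = complex_of_real \<kappa>" and s0: "s \<noteq> 0"
    using \<kappa> by (auto simp: s_def)
  have a0: "a \<noteq> 0" and a2: "a\<^sup>2 = \<zeta> * cnj \<zeta>"
    using \<zeta>0 complex_norm_square[of \<zeta>] by (simp_all add: a_def)
  have w0: "w \<noteq> 0" and w_eq: "s / 2 * (w + 1 / (w * a\<^sup>2)) = 1"
    using spectral_parameter_identity[of "csqrt (a\<^sup>2 - complex_of_real \<kappa>)" a s] s0 a0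
    by (simp_all add: w_def s2)
  define \<tau> where "\<tau> = cmod w * cmod \<zeta>"
  have \<tau>: "\<tau> > 0"
    using w0 \<zeta>0 by (simp add: \<tau>_def)
  have T0: "T \<noteq> 0" "cmod T = \<tau>" and U0: "U \<noteq> 0" "cmod U = \<tau>"
    using w0 \<zeta>0 by (simp_all add: T_def U_def \<tau>_def norm_mult)
  have h: "integrable lebesgue h"
    using f by (simp add: h_def set_integrable_def)
  have h_meas: "h \<in> borel_measurable lebesgue"
    using h by simp
  \<comment> \<open>Bound for the generating function at modulus \<open>\<tau>\<close> and argument
    of modulus at most \<open>cmod s\<close>, hence uniform over the disk.\<close>
  define C where "C = exp (cmod s * (\<tau> + 1 / \<tau>) / 2)"
  \<comment> \<open>The factor \<open>2 * pi\<close> absorbs the two normalisations of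
    \<open>circle_e\<close>, and the summand splits into an \<open>l\<close>-factor and an
    \<open>m\<close>-factor.\<close>
  have q_eq: "q (l, m) x = (bessel_J l (s * complex_of_real (cmod x)) * (T * cnj (sgn x)) powi l) *
      (bessel_J m (s * complex_of_real (cmod x)) * (U * sgn x) powi m)" for l m x
  proof -
    have "bessel_J n s * phi \<kappa> n (cmod x) = bessel_J n (s * complex_of_real (cmod x))" for n
      unfolding s_def by (rule bessel_J_mult_phi[OF J])
    moreover have "\<i> powi (l + m) * w powi (l + m) = \<i> powi l * w powi l * (\<i> powi m * w powi m)"
      using w0 by (simp add: power_int_add)
    moreover have "2 * complex_of_real pi * (cnj (circle_e l (sgn x)) * circle_e m (sgn x)) =
        cnj (sgn x) powi l * sgn x powi m"
    proof -
      have "complex_of_real (sqrt (2 * pi)) * complex_of_real (sqrt (2 * pi)) = complex_of_real (2 * pi)"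
        by (simp only: of_real_mult[symmetric]) simp
      then show ?thesis
        by (simp add: circle_e_def field_simps)
    qed
    moreover have "q (l, m) x = (\<i> powi (l + m) * w powi (l + m)) * cnj \<zeta> powi l * \<zeta> powi m *
        (bessel_J l s * phi \<kappa> l (cmod x)) * (bessel_J m s * phi \<kappa> m (cmod x)) *
        (2 * complex_of_real pi * (cnj (circle_e l (sgn x)) * circle_e m (sgn x)))"
      by (simp add: q_def mult_ac)
    ultimately show ?thesis
      by (simp add: T_def U_def power_int_mult_distrib mult_ac)
  qed
  have q_bound: "(\<Sum>p\<in>F. cmod (q p x)) \<le> C * C"
    if F: "finite F" and x: "x \<noteq> 0" "x \<in> unit_disk" for F x
  proof -
    define z where "z = s * complex_of_real (cmod x)"
    have C_ge: "(\<Sum>n\<in>G. cmod (bessel_J n z * t powi n)) \<le> C" if "finite G" "cmod t = \<tau>" for G t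
    proof -
      have "(\<Sum>n\<in>G. cmod (bessel_J n z * t powi n)) \<le> exp (cmod z * (cmod t + 1 / cmod t) / 2)"
        using that \<tau> by (intro bessel_J_finite_sum_le) auto
      also have "\<dots> \<le> C"
        unfolding C_def using x \<tau> that
        by (auto simp: z_def norm_mult intro!: divide_right_mono mult_right_mono mult_left_le)
      finally show ?thesis .
    qed
    have sgn_x: "cmod (sgn x) = 1"
      using x by (simp add: norm_sgn)
    \<comment> \<open>Enlarging \<open>F\<close> to the product of its projections lets the double
      sum factor.\<close>
    have "(\<Sum>p\<in>F. cmod (q p x)) \<le> (\<Sum>p\<in>fst ` F \<times> snd ` F. cmod (q p x))"
      using F by (intro sum_mono2) force+
    also have "\<dots> = (\<Sum>l\<in>fst ` F. cmod (bessel_J l z * (T * cnj (sgn x)) powi l)) *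
        (\<Sum>m\<in>snd ` F. cmod (bessel_J m z * (U * sgn x) powi m))"
      unfolding sum_product sum.cartesian_product
      by (intro sum.cong refl) (auto simp: q_eq z_def norm_mult)
    also have "\<dots> \<le> C * C"
      using F T0 U0 sgn_x by (intro mult_mono C_ge sum_nonneg) (auto simp: norm_mult C_def)
    finally show ?thesis .
  qed
  \<comment> \<open>At the origin \<open>sgn\<close> is 0 and leaves the unit circle; this point is
    a null set.\<close>
  have AE_0: "AE x in lebesgue. x \<noteq> (0 :: complex)"
    using AE_not_in[of "{0 :: complex}" lebesgue] by simp
  have bound: "AE x in lebesgue. \<forall>F. finite F \<longrightarrow> (\<Sum>p\<in>F. cmod (h x * q p x)) \<le> C * C * cmod (h x)"
    using AE_0
  proof eventually_elim
    case (elim x)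
    show ?case
    proof (intro allI impI)
      fix F :: "(int \<times> int) set"
      assume F: "finite F"
      have "(\<Sum>p\<in>F. cmod (h x * q p x)) = cmod (h x) * (\<Sum>p\<in>F. cmod (q p x))"
        by (simp add: norm_mult sum_distrib_left)
      also have "\<dots> \<le> cmod (h x) * (C * C)"
        using q_bound[OF F elim] by (cases "x \<in> unit_disk") (auto simp: h_def intro!: mult_left_mono)
      finally show "(\<Sum>p\<in>F. cmod (h x * q p x)) \<le> C * C * cmod (h x)"
        by (simp add: mult_ac)
    qed
  qed
  have q_meas: "q p \<in> borel_measurable lebesgue" for p
  proof -
    have [measurable]: "(\<lambda>x. cnj (circle_e l (sgn x))) \<in> borel_measurable borel" for l
      by (rule measurable_compose[OF circle_e_sgn_measurable])
        (intro borel_measurable_continuous_onI continuous_intros)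
    note [measurable] = phi_measurable circle_e_sgn_measurable
    have "q p \<in> borel_measurable borel"
      unfolding q_def by (cases p) (simp, measurable)
    then show ?thesis
      by (intro measurable_completion) simp
  qed
  have int: "integrable lebesgue (\<lambda>x. h x * q p x)" for p
    using h q_meas
  proof (rule integrable_mult_bounded_AE)
    show "AE x in lebesgue. cmod (h x * q p x) \<le> (C * C) * cmod (h x)"
      using bound by eventually_elim (drule spec[of _ "{p}"], simp)
  qed
  have has_sum: "((\<lambda>p. q p x) has_sum e x) UNIV" if x: "x \<noteq> 0" for x
  proof -
    define z where "z = s * complex_of_real (cmod x)"
    define t u where "t = T * cnj (sgn x)" and "u = U * sgn x"
    have t0: "t \<noteq> 0" and u0: "u \<noteq> 0"
      using T0 U0 x by (simp_all add: t_def u_def sgn_zero_iff)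
    have "((\<lambda>(l, m). (bessel_J l z * t powi l) * (bessel_J m z * u powi m)) has_sum
        exp (z / 2 * (t - 1 / t)) * exp (z / 2 * (u - 1 / u))) (UNIV \<times> UNIV)"
      by (intro has_sum_mult_Times bessel_J_abs_summable bessel_J_has_sum t0 u0)
    moreover have "exp (z / 2 * (t - 1 / t)) * exp (z / 2 * (u - 1 / u)) = e x"
    proof -
      have sgn1: "sgn x * cnj (sgn x) = 1"
        using x by (simp add: complex_norm_square[symmetric] norm_sgn)
      have wa: "w * a\<^sup>2 \<noteq> 0"
        using w0 a0 by simp
      have one: "(- \<i> * \<i>) * (w * (\<zeta> * cnj \<zeta>) / (w * a\<^sup>2)) * (sgn x * cnj (sgn x)) = 1"
        using wa unfolding sgn1 a2[symmetric] by simp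
      have "t * (- \<i> * (1 / (w * a\<^sup>2)) * (\<zeta> * sgn x)) = 1"
        by (rule trans[OF _ one]) (simp add: t_def T_def mult_ac)
      moreover have "u * (- \<i> * (1 / (w * a\<^sup>2)) * (cnj \<zeta> * cnj (sgn x))) = 1"
        by (rule trans[OF _ one]) (simp add: u_def U_def mult_ac)
      ultimately have inv: "1 / t = - \<i> * (1 / (w * a\<^sup>2)) * (\<zeta> * sgn x)"
        "1 / u = - \<i> * (1 / (w * a\<^sup>2)) * (cnj \<zeta> * cnj (sgn x))"
        unfolding inverse_eq_divide[symmetric] by (blast intro: inverse_unique)+
      \<comment> \<open>The reciprocal of \<open>t\<close> carries \<open>\<zeta> * sgn x\<close>,
        as \<open>u\<close> does, and that of \<open>u\<close> carries the conjugate, as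
        \<open>t\<close> does. The sum therefore groups into the factor evaluated in
        \<open>w_eq\<close> times a real part, which is the inner product since
        \<open>\<zeta> = - cnj \<xi> / 2\<close>.\<close>
      have "z / 2 * (t - 1 / t) + z / 2 * (u - 1 / u) =
          \<i> * (s / 2 * (w + 1 / (w * a\<^sup>2))) * (complex_of_real (cmod x) * (\<zeta> * sgn x + cnj \<zeta> * cnj (sgn x)))"
        unfolding inv by (simp add: z_def t_def u_def T_def U_def algebra_simps)
      also have "\<dots> = \<i> * (\<zeta> * x + cnj (\<zeta> * x))"
        using x unfolding w_eq by (simp add: sgn_eq distrib_left mult_ac)
      also have "\<dots> = - \<i> * complex_of_real (x \<bullet> \<xi>)"
        by (simp add: \<zeta>_cnj complex_eq_iff inner_complex_def field_simps)
      finally show ?thesis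
        by (simp add: e_def exp_add[symmetric])
    qed
    moreover have "(\<lambda>(l, m). (bessel_J l z * t powi l) * (bessel_J m z * u powi m)) = (\<lambda>p. q p x)"
      by (auto simp: q_eq z_def t_def u_def)
    ultimately show ?thesis
      by simp
  qed
  have sum: "AE x in lebesgue. ((\<lambda>p. h x * q p x) has_sum h x * e x) UNIV"
    using AE_0 by eventually_elim (intro has_sum_cmult_right has_sum)
  have "e \<in> borel_measurable lebesgue"
    unfolding e_def by (intro borel_measurable_lebesgue_of_continuous continuous_intros)
  then have S: "(\<lambda>x. h x * e x) \<in> borel_measurable lebesgue"
    using h_meas by simp
  have integral_q: "(\<integral>x. h x * q (l, m) x \<partial>lebesgue) = 2 * complex_of_real pi * series_term \<kappa> f \<zeta> l m" for l m
  proof -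
    have "moment \<kappa> l m f = (\<integral>x. h x * (phi \<kappa> l (cmod x) * phi \<kappa> m (cmod x) *
        cnj (circle_e l (sgn x)) * circle_e m (sgn x)) \<partial>lebesgue)"
      by (simp add: moment_def set_lebesgue_integral_def h_def mult.assoc)
    then show ?thesis
      unfolding series_term_def Let_def s_def[symmetric] a_def[symmetric] w_def[symmetric] q_def
      by (simp add: mult_ac flip: integral_mult_right_zero)
  qed
  have integral_e: "(\<integral>x. h x * e x \<partial>lebesgue) = fourier f \<xi>"
    by (simp add: fourier_def set_lebesgue_integral_def h_def e_def mult_ac)
  have B: "integrable lebesgue (\<lambda>x. C * C * cmod (h x))"
    using h by simp
  have eq: "(\<integral>x. h x * q p x \<partial>lebesgue) =
      (case p of (l, m) \<Rightarrow> 2 * complex_of_real pi * series_term \<kappa> f \<zeta> l m)" for p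
    by (cases p) (simp add: integral_q)
  show "(\<lambda>(l, m). cmod (2 * complex_of_real pi * series_term \<kappa> f \<zeta> l m)) summable_on UNIV"
    using has_sum_integral(1)[OF int B bound sum S] by (simp add: eq case_prod_unfold)
  show "((\<lambda>(l, m). 2 * complex_of_real pi * series_term \<kappa> f \<zeta> l m) has_sum fourier f \<xi>) UNIV"
    using has_sum_integral(2)[OF int B bound sum S] by (simp only: eq integral_e)
qed

section \<open>The moment series of the Fourier transform and injectivity of the moments\<close>

theorem theorem3p8:
  fixes \<kappa> :: real
  assumes "\<kappa> \<noteq> 0"
    and "\<And>l :: int. \<kappa> > 0 \<Longrightarrow> bessel_J \<bar>l\<bar> (csqrt (complex_of_real \<kappa>)) \<noteq> 0"
  shows "(\<forall>(f :: complex \<Rightarrow> complex) (\<xi> :: complex) (\<zeta> :: complex).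
            f absolutely_integrable_on unit_disk \<longrightarrow> \<xi> \<noteq> 0 \<longrightarrow>
            \<zeta> = - (complex_of_real (Re \<xi>) - \<i> * complex_of_real (Im \<xi>)) / 2 \<longrightarrow>
            (\<lambda>(l :: int, m :: int). cmod (series_term \<kappa> f \<zeta> l m)) summable_on UNIV \<and>
            fourier f \<xi> =
              2 * complex_of_real pi * (\<Sum>\<^sub>\<infinity>(l :: int, m :: int)\<in>UNIV. series_term \<kappa> f \<zeta> l m)) \<and>
         (\<forall>(f :: complex \<Rightarrow> complex) (g :: complex \<Rightarrow> complex).
            f absolutely_integrable_on unit_disk \<longrightarrow> g absolutely_integrable_on unit_disk \<longrightarrow>
            (\<forall>(l :: int) (m :: int). moment \<kappa> l m f = moment \<kappa> l m g) \<longrightarrow>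
            (AE x in lebesgue. x \<in> unit_disk \<longrightarrow> f x = g x))"
proof (intro conjI allI impI)
  \<comment> \<open>Positive \<open>\<kappa>\<close> is covered by the assumption, negative
    \<open>\<kappa>\<close> by nonvanishing on the imaginary axis.\<close>
  have J: "bessel_J \<bar>l\<bar> (csqrt (complex_of_real \<kappa>)) \<noteq> 0" for l
    using assms bessel_J_sqrt_nonzero[of \<kappa> l] by (cases "\<kappa> > 0") auto
  note series = fourier_has_sum[OF assms(1) J]
  {
    fix f :: "complex \<Rightarrow> complex" and \<xi> \<zeta> :: complex
    assume f: "f absolutely_integrable_on unit_disk" and \<xi>: "\<xi> \<noteq> 0"
      and \<zeta>: "\<zeta> = - (complex_of_real (Re \<xi>) - \<i> * complex_of_real (Im \<xi>)) / 2"
    show "(\<lambda>(l, m). cmod (series_term \<kappa> f \<zeta> l m)) summable_on UNIV"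
      using series(1)[OF f \<xi> \<zeta>]
      by (simp add: norm_mult case_prod_unfold summable_on_cmult_right')
    have "fourier f \<xi> = (\<Sum>\<^sub>\<infinity>p. 2 * complex_of_real pi * (case p of (l, m) \<Rightarrow> series_term \<kappa> f \<zeta> l m))"
      using infsumI[OF series(2)[OF f \<xi> \<zeta>]] by (simp add: case_prod_unfold)
    also have "\<dots> = 2 * complex_of_real pi * (\<Sum>\<^sub>\<infinity>(l, m). series_term \<kappa> f \<zeta> l m)"
      by (rule infsum_cmult_right')
    finally show "fourier f \<xi> = 2 * complex_of_real pi * (\<Sum>\<^sub>\<infinity>(l, m)\<in>UNIV. series_term \<kappa> f \<zeta> l m)" .
  }
  fix f g :: "complex \<Rightarrow> complex"
  assume f: "f absolutely_integrable_on unit_disk" and g: "g absolutely_integrable_on unit_disk"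
    and moments: "\<forall>l m. moment \<kappa> l m f = moment \<kappa> l m g"
  define h where "h = (\<lambda>x. indicator unit_disk x *\<^sub>R f x - indicator unit_disk x *\<^sub>R g x)"
  have int: "integrable lebesgue (\<lambda>x. indicator unit_disk x *\<^sub>R k x)"
    if "k absolutely_integrable_on unit_disk" for k :: "complex \<Rightarrow> complex"
    using that by (simp add: set_integrable_def)
  have "AE x in lebesgue. h x = 0"
  proof (rule fourier_integral_injective)
    show "integrable lebesgue h"
      unfolding h_def by (intro Bochner_Integration.integrable_diff int f g)
    show "compact (cball (0 :: complex) 1)"
      by simp
    show "h x = 0" if "x \<notin> cball 0 1" for x
      using that by (auto simp: h_def indicator_def)
    fix \<xi> :: complex
    assume \<xi>: "\<xi> \<noteq> 0"
    have int_exp: "integrable lebesgue (\<lambda>x. (indicator unit_disk x *\<^sub>R k x) * exp (- \<i> * complex_of_real (x \<bullet> \<xi>)))"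
      if "k absolutely_integrable_on unit_disk" for k :: "complex \<Rightarrow> complex"
      using int[OF that]
      by (rule integrable_mult_bounded_AE[where C = 1])
        (auto simp: norm_mult intro!: borel_measurable_lebesgue_of_continuous continuous_intros)
    \<comment> \<open>A series term depends on the function only through its moment, so both
      transforms are the sum of one and the same family.\<close>
    have "fourier f \<xi> = fourier g \<xi>"
      using series(2)[OF f \<xi> refl] series(2)[OF g \<xi> refl] moments
      by (auto simp: series_term_def intro: has_sum_unique)
    moreover have "(\<integral>x. exp (- \<i> * complex_of_real (x \<bullet> \<xi>)) * h x \<partial>lebesgue) =
        fourier f \<xi> - fourier g \<xi>"
      using Bochner_Integration.integral_diff[OF int_exp[OF f] int_exp[OF g]]
      by (simp add: fourier_def set_lebesgue_integral_def h_def algebra_simps)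
    ultimately show "(\<integral>x. exp (- \<i> * complex_of_real (x \<bullet> \<xi>)) * h x \<partial>lebesgue) = 0"
      by simp
  qed
  then show "AE x in lebesgue. x \<in> unit_disk \<longrightarrow> f x = g x"
    by eventually_elim (auto simp: h_def)
qed

end
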